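(* Let $A,B,C$ be nonempty finite subsets of $\mathbb{R}\setminus\{0,-1\}$. Then $$|AB|\cdot|(A+1)C|\gg \sqrt{|A|^3\cdot|B|\cdot|C|},$$ where the implied constant is absolute.
   Context: For sets $X,Y\subset\mathbb{R}$, $XY=\{xy: x\in X, y\in Y\}$ and $X+1=\{x+1:x\in X\}$. The notation $U\gg V$ means $U\ge cV$ for some absolute constant $c>0$. *)

theory Defs
  imports Complex_Main "HOL-Library.Set_Algebras"
begin

end

theory Submission
  imports Defs
begin

text \<open>
  For \<open>b \<in> B\<close> and \<open>c \<in> C\<close> the line \<open>y = (c/b) x + c\<close> contains the \<open>|A|\<close> points
  \<open>(ab, (a+1)c)\<close> of \<open>X \<times> Y\<close>, where \<open>X = AB\<close> and \<open>Y = (A+1)C\<close>. It remains to bound the number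
  of \<open>k\<close>-rich lines of a grid \<open>X \<times> Y\<close> by \<open>O(|X|\<^sup>2|Y|\<^sup>2/k\<^sup>3)\<close>, and for this a cell decomposition
  replaces the Szemeredi--Trotter theorem. Cut \<open>X\<close> and \<open>Y\<close> into \<open>q\<close> intervals each, of about
  equal cardinality. By monotonicity a line visits at most \<open>2q - 1\<close> of the \<open>q\<^sup>2\<close> cells, so at
  least \<open>k - (2q - 1)\<close> pairs of distinct points on it share a cell. Different lines have no
  such pair in common, and only about \<open>|X|\<^sup>2|Y|\<^sup>2/q\<^sup>2\<close> pairs of grid points share a cell. Take
  \<open>q\<close> about \<open>k/4\<close>.
\<close>

subsection \<open>Pairs of points in a common fibre\<close>

definition kernel_pairs :: "('a \<Rightarrow> 'b) \<Rightarrow> 'a set \<Rightarrow> ('a \<times> 'a) set" where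
  "kernel_pairs f S = {(u, v). u \<in> S \<and> v \<in> S \<and> f u = f v}"

lemma kernel_pairs_mono: "S \<subseteq> T \<Longrightarrow> kernel_pairs f S \<subseteq> kernel_pairs f T"
  by (auto simp: kernel_pairs_def)

lemma finite_kernel_pairs: "finite S \<Longrightarrow> finite (kernel_pairs f S)"
  by (rule finite_subset[of _ "S \<times> S"]) (auto simp: kernel_pairs_def)

lemma card_kernel_pairs_le:
  assumes "finite S" and "\<And>j. card {v \<in> S. f v = j} \<le> m"
  shows "card (kernel_pairs f S) \<le> card S * m"
proof -
  have "kernel_pairs f S = (SIGMA u:S. {v \<in> S. f v = f u})"
    by (auto simp: kernel_pairs_def)
  then have "card (kernel_pairs f S) = (\<Sum>u\<in>S. card {v \<in> S. f v = f u})"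
    using assms(1) by (simp add: card_SigmaI)
  also have "\<dots> \<le> card S * m"
    using sum_bounded_above[of S _ m] assms(2) by simp
  finally show ?thesis .
qed

lemma card_kernel_pairs_map_prod:
  "card (kernel_pairs (map_prod f g) (S \<times> T)) = card (kernel_pairs f S) * card (kernel_pairs g T)"
proof -
  let ?swap = "\<lambda>((x, x'), (y, y')). ((x, y), (x', y'))"
  have "kernel_pairs (map_prod f g) (S \<times> T) = ?swap ` (kernel_pairs f S \<times> kernel_pairs g T)"
    by (auto simp: kernel_pairs_def image_iff)
  moreover have "inj_on ?swap (kernel_pairs f S \<times> kernel_pairs g T)"
    by (auto intro: inj_onI)
  ultimately show ?thesis
    by (simp only: card_image card_cartesian_product)
qed

lemma card_le_card_image_add_kernel_pairs:
  assumes "finite S"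
  shows "card S \<le> card (f ` S) + card (kernel_pairs f S - Id)"
proof -
  define rep where "rep u = inv_into S f (f u)" for u
  have rep: "rep u \<in> S" "f (rep u) = f u" if "u \<in> S" for u
    using that by (simp_all add: rep_def inv_into_into f_inv_into_f)
  have "{u \<in> S. rep u = u} \<subseteq> inv_into S f ` f ` S"
    by (force simp: rep_def)
  then have fixed: "card {u \<in> S. rep u = u} \<le> card (f ` S)"
    using assms by (simp add: surj_card_le)
  have "(\<lambda>u. (u, rep u)) ` {u \<in> S. rep u \<noteq> u} \<subseteq> kernel_pairs f S - Id"
    using rep by (auto simp: kernel_pairs_def)
  then have moved: "card {u \<in> S. rep u \<noteq> u} \<le> card (kernel_pairs f S - Id)"
    using assms by (intro card_inj_on_le finite_Diff finite_kernel_pairs) (auto intro: inj_onI)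
  have "card S = card {u \<in> S. rep u = u} + card {u \<in> S. rep u \<noteq> u}"
    using assms by (subst card_Un_disjoint[symmetric]) (auto intro: arg_cong[of _ _ card])
  then show ?thesis
    using fixed moved by linarith
qed

subsection \<open>Partition into intervals of nearly equal cardinality\<close>

definition rank :: "'a::preorder set \<Rightarrow> 'a \<Rightarrow> nat" where
  "rank X x = card {y \<in> X. y < x}"

lemma mono_rank: "finite X \<Longrightarrow> mono (rank X)"
  unfolding rank_def by (auto intro!: monoI card_mono intro: less_le_trans)

lemma rank_strict_mono: "finite X \<Longrightarrow> x \<in> X \<Longrightarrow> x < y \<Longrightarrow> rank X x < rank X y"
  unfolding rank_def by (rule psubset_card_mono) (auto intro: less_trans)

lemma rank_less_card: "finite X \<Longrightarrow> x \<in> X \<Longrightarrow> rank X x < card X"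
  unfolding rank_def by (rule psubset_card_mono) auto

lemma inj_on_rank:
  fixes X :: "'a::linorder set"
  assumes "finite X"
  shows "inj_on (rank X) X"
  by (rule linorder_inj_onI) (use rank_strict_mono[OF assms] in \<open>auto simp: less_imp_neq\<close>)

lemma card_rank_div_fibre_le:
  fixes X :: "'a::linorder set"
  assumes "finite X" "0 < m"
  shows "card {x \<in> X. rank X x div m = j} \<le> m"
proof -
  have "rank X ` {x \<in> X. rank X x div m = j} \<subseteq> {j * m..<j * m + m}"
    using dividend_less_div_times[OF assms(2)] by (auto simp: add.commute)
  moreover have "inj_on (rank X) {x \<in> X. rank X x div m = j}"
    using inj_on_rank[OF assms(1)] by (rule inj_on_subset) auto
  ultimately show ?thesis
    using card_inj_on_le[of "rank X" _ "{j * m..<j * m + m}"] by simp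
qed

lemma ex_mono_equipartition:
  fixes X :: "'a::linorder set"
  assumes "finite X" "0 < q" "q \<le> card X"
  shows "\<exists>r::'a \<Rightarrow> nat. mono r \<and> r ` X \<subseteq> {..<q} \<and> q * card (kernel_pairs r X) \<le> 2 * (card X)\<^sup>2"
proof (intro exI conjI)
  define m where "m = card X div q + 1"
  define r where "r x = rank X x div m" for x
  have "0 < m" by (simp add: m_def)
  show "mono r"
    unfolding r_def using monoD[OF mono_rank[OF assms(1)]] by (intro monoI div_le_mono)
  have "card X < q * m"
    using dividend_less_div_times[OF assms(2), of "card X"] by (simp add: m_def algebra_simps)
  then show "r ` X \<subseteq> {..<q}"
    using rank_less_card[OF assms(1)] by (fastforce simp: r_def intro: less_mult_imp_div_less)
  have "card (kernel_pairs r X) \<le> card X * m"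
    unfolding r_def using assms(1) \<open>0 < m\<close> by (intro card_kernel_pairs_le card_rank_div_fibre_le)
  then have "q * card (kernel_pairs r X) \<le> card X * (q * m)"
    by (metis mult.left_commute mult_le_mono2)
  also have "q * m \<le> 2 * card X"
    using add_mono[OF assms(3) times_div_less_eq_dividend[of q "card X"]] by (simp add: m_def)
  finally show "q * card (kernel_pairs r X) \<le> 2 * (card X)\<^sup>2"
    by (simp add: power2_eq_square mult.left_commute)
qed

subsection \<open>Monotone curves in a grid\<close>

abbreviation increasing_set :: "('a::ord \<times> 'b::ord) set \<Rightarrow> bool" where
  "increasing_set \<equiv> Complete_Partial_Order.chain (rel_prod (\<le>) (\<le>))"

abbreviation decreasing_set :: "('a::ord \<times> 'b::ord) set \<Rightarrow> bool" where
  "decreasing_set \<equiv> Complete_Partial_Order.chain (rel_prod (\<le>) (\<ge>))"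

lemma card_increasing_grid_chain_le:
  fixes D :: "(nat \<times> nat) set"
  assumes "increasing_set D" and "D \<subseteq> {..<q} \<times> {..<q}"
  shows "card D \<le> 2 * q - 1"
proof -
  have "inj_on (\<lambda>(i, j). i + j) D"
  proof (rule inj_onI, clarify)
    fix i j i' j' assume "(i, j) \<in> D" "(i', j') \<in> D" "i + j = i' + j'"
    then show "i = i' \<and> j = j'"
      using chainD[OF assms(1), of "(i, j)" "(i', j')"] by auto
  qed
  moreover have "(\<lambda>(i, j). i + j) ` D \<subseteq> {..<2 * q - 1}"
    using assms(2) by (auto dest!: subsetD)
  ultimately show ?thesis
    using card_inj_on_le[of _ D "{..<2 * q - 1}"] by simp
qed

lemma card_decreasing_grid_chain_le:
  fixes D :: "(nat \<times> nat) set"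
  assumes "decreasing_set D" and "D \<subseteq> {..<q} \<times> {..<q}"
  shows "card D \<le> 2 * q - 1"
proof -
  let ?reflect = "apsnd (\<lambda>j. q - 1 - j)"
  have "increasing_set (?reflect ` D)"
    using assms(1) by (rule chain_imageI) auto
  then have "card (?reflect ` D) \<le> 2 * q - 1"
    using assms(2) by (intro card_increasing_grid_chain_le) fastforce+
  moreover have "inj_on ?reflect ({..<q} \<times> {..<q})"
    by (auto intro!: inj_onI)
  then have "inj_on ?reflect D"
    using assms(2) by (rule inj_on_subset)
  ultimately show ?thesis
    by (simp add: card_image)
qed

definition strictly_monotone_graph :: "('a::linorder \<times> 'b::linorder) set \<Rightarrow> bool" where
  "strictly_monotone_graph S \<longleftrightarrow> inj_on fst S \<and> inj_on snd S \<and>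
     (increasing_set S \<or> decreasing_set S)"

lemma card_strictly_monotone_graph_le:
  assumes "strictly_monotone_graph S" "S \<subseteq> X \<times> Y" "finite X" "finite Y"
  shows "card S \<le> card X" and "card S \<le> card Y"
proof -
  have "fst ` S \<subseteq> X" "snd ` S \<subseteq> Y"
    using assms(2) by auto
  then show "card S \<le> card X" "card S \<le> card Y"
    using assms card_inj_on_le[of fst S X] card_inj_on_le[of snd S Y]
    by (simp_all add: strictly_monotone_graph_def)
qed

lemma card_cells_strictly_monotone_graph_le:
  fixes r :: "'a::linorder \<Rightarrow> nat" and s :: "'b::linorder \<Rightarrow> nat"
  assumes "strictly_monotone_graph S" "S \<subseteq> X \<times> Y"
    and "mono r" "mono s" "r ` X \<subseteq> {..<q}" "s ` Y \<subseteq> {..<q}"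
  shows "card (map_prod r s ` S) \<le> 2 * q - 1"
proof -
  have grid: "map_prod r s ` S \<subseteq> {..<q} \<times> {..<q}"
    using assms(2,5,6) by fastforce
  from assms(1) consider (increasing) "increasing_set S" | (decreasing) "decreasing_set S"
    by (auto simp: strictly_monotone_graph_def)
  then show ?thesis
  proof cases
    case increasing
    then have "increasing_set (map_prod r s ` S)"
      by (rule chain_imageI) (auto intro: monoD[OF assms(3)] monoD[OF assms(4)])
    then show ?thesis
      using grid by (rule card_increasing_grid_chain_le)
  next
    case decreasing
    then have "decreasing_set (map_prod r s ` S)"
      by (rule chain_imageI) (auto intro: monoD[OF assms(3)] monoD[OF assms(4)])
    then show ?thesis
      using grid by (rule card_decreasing_grid_chain_le)
  qed
qed

lemma sum_card_kernel_pairs_diff_Id_le: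
  assumes "finite L" "finite Z" and sub: "\<And>l. l \<in> L \<Longrightarrow> P l \<subseteq> Z"
    and meet: "\<And>l l'. l \<in> L \<Longrightarrow> l' \<in> L \<Longrightarrow> l \<noteq> l' \<Longrightarrow> card (P l \<inter> P l') \<le> 1"
  shows "(\<Sum>l\<in>L. card (kernel_pairs f (P l) - Id)) \<le> card (kernel_pairs f Z)"
proof -
  have fin: "finite (P l)" if "l \<in> L" for l
    using sub[OF that] assms(2) by (rule finite_subset)
  have "(kernel_pairs f (P l) - Id) \<inter> (kernel_pairs f (P l') - Id) = {}"
    if "l \<in> L" "l' \<in> L" "l \<noteq> l'" for l l'
    using meet[OF that] fin[OF that(1)] by (auto simp: card_le_Suc0_iff_eq kernel_pairs_def)
  then have "(\<Sum>l\<in>L. card (kernel_pairs f (P l) - Id))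
      = card (\<Union>l\<in>L. kernel_pairs f (P l) - Id)"
    using assms(1) fin by (intro card_UN_disjoint[symmetric]) (simp_all add: finite_kernel_pairs)
  also have "\<dots> \<le> card (kernel_pairs f Z)"
    using kernel_pairs_mono[OF sub] finite_kernel_pairs[OF assms(2)] by (intro card_mono) blast+
  finally show ?thesis .
qed

lemma card_curves_mult_cells_le:
  fixes P :: "'i \<Rightarrow> ('a::linorder \<times> 'b::linorder) set"
  assumes fin: "finite L" "finite X" "finite Y"
    and sub: "\<And>l. l \<in> L \<Longrightarrow> P l \<subseteq> X \<times> Y"
    and curve: "\<And>l. l \<in> L \<Longrightarrow> strictly_monotone_graph (P l)"
    and meet: "\<And>l l'. l \<in> L \<Longrightarrow> l' \<in> L \<Longrightarrow> l \<noteq> l' \<Longrightarrow> card (P l \<inter> P l') \<le> 1"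
    and rich: "\<And>l. l \<in> L \<Longrightarrow> k \<le> card (P l)"
    and q: "0 < q" "q \<le> card X" "q \<le> card Y"
  shows "card L * (k - (2 * q - 1)) * q\<^sup>2 \<le> 4 * (card X * card Y)\<^sup>2"
proof -
  obtain r :: "'a \<Rightarrow> nat" where r: "mono r" "r ` X \<subseteq> {..<q}"
    "q * card (kernel_pairs r X) \<le> 2 * (card X)\<^sup>2"
    using ex_mono_equipartition[OF fin(2) q(1,2)] by blast
  obtain s :: "'b \<Rightarrow> nat" where s: "mono s" "s ` Y \<subseteq> {..<q}"
    "q * card (kernel_pairs s Y) \<le> 2 * (card Y)\<^sup>2"
    using ex_mono_equipartition[OF fin(3) q(1,3)] by blast
  let ?cell = "map_prod r s"
  have many: "k - (2 * q - 1) \<le> card (kernel_pairs ?cell (P l) - Id)" if l: "l \<in> L" for l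
  proof -
    have "finite (P l)"
      using finite_subset[OF sub[OF l]] fin by simp
    then have "k \<le> card (?cell ` P l) + card (kernel_pairs ?cell (P l) - Id)"
      using rich[OF l] by (blast intro: le_trans card_le_card_image_add_kernel_pairs)
    moreover have "card (?cell ` P l) \<le> 2 * q - 1"
      using curve[OF l] sub[OF l] r(1) s(1) r(2) s(2) by (rule card_cells_strictly_monotone_graph_le)
    ultimately show ?thesis by linarith
  qed
  have "card L * (k - (2 * q - 1)) \<le> (\<Sum>l\<in>L. card (kernel_pairs ?cell (P l) - Id))"
    using sum_bounded_below[OF many] by simp
  also have "\<dots> \<le> card (kernel_pairs ?cell (X \<times> Y))"
    using fin by (intro sum_card_kernel_pairs_diff_Id_le sub meet) simp_all
  also have "\<dots> = card (kernel_pairs r X) * card (kernel_pairs s Y)"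
    by (rule card_kernel_pairs_map_prod)
  finally have "card L * (k - (2 * q - 1)) * q\<^sup>2
      \<le> card (kernel_pairs r X) * card (kernel_pairs s Y) * q\<^sup>2"
    by (rule mult_le_mono1)
  also have "\<dots> = (q * card (kernel_pairs r X)) * (q * card (kernel_pairs s Y))"
    by (simp add: power2_eq_square)
  also have "\<dots> \<le> (2 * (card X)\<^sup>2) * (2 * (card Y)\<^sup>2)"
    using r(3) s(3) by (rule mult_le_mono)
  finally show ?thesis
    by (simp add: power_mult_distrib)
qed

theorem card_rich_curves_le:
  fixes P :: "'i \<Rightarrow> ('a::linorder \<times> 'b::linorder) set"
  assumes fin: "finite L" "finite X" "finite Y"
    and sub: "\<And>l. l \<in> L \<Longrightarrow> P l \<subseteq> X \<times> Y"
    and curve: "\<And>l. l \<in> L \<Longrightarrow> strictly_monotone_graph (P l)"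
    and meet: "\<And>l l'. l \<in> L \<Longrightarrow> l' \<in> L \<Longrightarrow> l \<noteq> l' \<Longrightarrow> card (P l \<inter> P l') \<le> 1"
    and rich: "\<And>l. l \<in> L \<Longrightarrow> k \<le> card (P l)" and "2 \<le> k"
  shows "card L * k ^ 3 \<le> 256 * (card X * card Y)\<^sup>2"
proof (cases "L = {}")
  case False
  then obtain l where l: "l \<in> L" by blast
  have kXY: "k \<le> card X" "k \<le> card Y"
    using rich[OF l] card_strictly_monotone_graph_le[OF curve[OF l] sub[OF l] fin(2,3)] by simp_all
  define q where "q = (k + 3) div 4"
  have "k \<le> 4 * q" "4 * q \<le> k + 3"
    unfolding q_def by presburger+
  then have q: "0 < q" "q \<le> k" "k \<le> 4 * q" "k \<le> 4 * (k - (2 * q - 1))"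
    using \<open>2 \<le> k\<close> by linarith+
  have "card L * k ^ 3 = card L * k * k\<^sup>2"
    by (simp add: power3_eq_cube power2_eq_square)
  also have "\<dots> \<le> card L * (4 * (k - (2 * q - 1))) * (4 * q)\<^sup>2"
    using q by (intro mult_le_mono power_mono) auto
  also have "\<dots> = 64 * (card L * (k - (2 * q - 1)) * q\<^sup>2)"
    by (simp add: power_mult_distrib)
  also have "\<dots> \<le> 64 * (4 * (card X * card Y)\<^sup>2)"
    using q kXY
    by (intro mult_le_mono2 card_curves_mult_cells_le[OF fin sub curve meet rich]) simp_all
  finally show ?thesis by simp
qed simp

subsection \<open>Rich lines and products of sets\<close>

definition line :: "'a::semiring \<Rightarrow> 'a \<Rightarrow> ('a \<times> 'a) set" where
  "line m t = {(x, y). y = m * x + t}"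

lemma line_Int_line_unique:
  fixes m t m' t' :: "'a::idom"
  assumes "(m, t) \<noteq> (m', t')"
    and "p \<in> line m t \<inter> line m' t'" "p' \<in> line m t \<inter> line m' t'"
  shows "p = p'"
proof -
  obtain x y x' y' where p: "p = (x, y)" "p' = (x', y')" by (meson surj_pair)
  have y: "y = m * x + t" "y' = m * x' + t"
    and eq: "m * x + t = m' * x + t'" "m * x' + t = m' * x' + t'"
    using assms(2,3) by (auto simp: line_def p)
  have "(m - m') * (x - x') = 0"
    using eq by algebra
  moreover have "m \<noteq> m'"
    using eq(1) assms(1) by auto
  ultimately show ?thesis
    using y by (simp add: p)
qed

lemma strictly_monotone_graph_subset_line:
  fixes m t :: "'a::linordered_idom"
  assumes "m \<noteq> 0" "S \<subseteq> line m t"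
  shows "strictly_monotone_graph S"
proof -
  have line: "snd p = m * fst p + t" if "p \<in> S" for p
    using that assms(2) by (auto simp: line_def)
  have "inj_on fst S"
    by (rule inj_onI) (simp add: line prod_eq_iff)
  moreover have "inj_on snd S"
    by (rule inj_onI) (use assms(1) in \<open>simp add: line prod_eq_iff\<close>)
  moreover have "increasing_set S" if "0 < m"
    by (rule chainI) (use that linear in \<open>simp add: rel_prod_sel line\<close>)
  moreover have "decreasing_set S" if "m < 0"
    by (rule chainI) (use that linear in \<open>simp add: rel_prod_sel line\<close>)
  ultimately show ?thesis
    using assms(1) by (auto simp: strictly_monotone_graph_def neq_iff)
qed

theorem card_rich_lines_le:
  fixes X Y :: "'a::linordered_idom set"
  assumes fin: "finite L" "finite X" "finite Y"
    and slope: "\<And>m t. (m, t) \<in> L \<Longrightarrow> m \<noteq> 0"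
    and rich: "\<And>m t. (m, t) \<in> L \<Longrightarrow> k \<le> card (line m t \<inter> X \<times> Y)" and "2 \<le> k"
  shows "card L * k ^ 3 \<le> 256 * (card X * card Y)\<^sup>2"
proof (rule card_rich_curves_le[where P = "\<lambda>(m, t). line m t \<inter> X \<times> Y"])
  fix l l' :: "'a \<times> 'a"
  assume "l \<noteq> l'"
  obtain m t m' t' where l: "l = (m, t)" "l' = (m', t')" by (meson surj_pair)
  let ?I = "line m t \<inter> X \<times> Y \<inter> (line m' t' \<inter> X \<times> Y)"
  have "\<forall>p\<in>?I. \<forall>p'\<in>?I. p = p'"
    using \<open>l \<noteq> l'\<close> line_Int_line_unique[of m t m' t'] unfolding l by blast
  then show "card ((\<lambda>(m, t). line m t \<inter> X \<times> Y) l \<inter> (\<lambda>(m, t). line m t \<inter> X \<times> Y) l') \<le> 1"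
    using fin by (simp add: l card_le_Suc0_iff_eq)
qed (use assms in \<open>auto intro: strictly_monotone_graph_subset_line\<close>)

lemma card_singleton_times:
  fixes a :: "'a::idom"
  assumes "a \<noteq> 0"
  shows "card ({a} * B) = card B"
proof -
  have "{a} * B = (*) a ` B"
    by (auto simp: set_times_image)
  then show ?thesis
    using assms by (simp add: card_image inj_on_def)
qed

lemma cube_card_le_product_sets_if_two_le:
  fixes A B C :: "'a::linordered_field set"
  assumes fin: "finite A" "finite B" "finite C"
    and nz: "0 \<notin> B" "0 \<notin> C" "d \<noteq> 0" and "2 \<le> card A"
  shows "card A ^ 3 * card B * card C \<le> 256 * (card (A * B) * card ((\<lambda>x. x + d) ` A * C))\<^sup>2"
proof -
  define L where "L = (\<lambda>(b, c). (c / b, d * c)) ` (B \<times> C)"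
  have rich: "card A \<le> card (line (c / b) (d * c) \<inter> (A * B) \<times> ((\<lambda>x. x + d) ` A * C))"
    if "b \<in> B" "c \<in> C" for b c
  proof (rule card_inj_on_le)
    have "b \<noteq> 0" using that nz by auto
    then show "inj_on (\<lambda>a. (a * b, (a + d) * c)) A"
      by (auto intro: inj_onI)
    have "(a * b, (a + d) * c) \<in> line (c / b) (d * c)" for a
      using \<open>b \<noteq> 0\<close> by (simp add: line_def distrib_right)
    then show "(\<lambda>a. (a * b, (a + d) * c)) ` A
        \<subseteq> line (c / b) (d * c) \<inter> (A * B) \<times> ((\<lambda>x. x + d) ` A * C)"
      using that by auto
  qed (use fin in \<open>simp add: finite_set_times\<close>)
  have "card L * card A ^ 3 \<le> 256 * (card (A * B) * card ((\<lambda>x. x + d) ` A * C))\<^sup>2"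
    using fin nz rich \<open>2 \<le> card A\<close>
    by (intro card_rich_lines_le) (auto simp: L_def finite_set_times)
  moreover have "inj_on (\<lambda>(b, c). (c / b, d * c)) (B \<times> C)"
    using nz by (auto intro!: inj_onI simp: field_simps)
  then have "card L = card B * card C"
    by (simp add: L_def card_image card_cartesian_product)
  ultimately show ?thesis
    by (simp add: ac_simps)
qed

theorem cube_card_le_product_sets:
  fixes A B C :: "'a::linordered_field set"
  assumes fin: "finite A" "finite B" "finite C"
    and nz: "0 \<notin> A" "- d \<notin> A" "0 \<notin> B" "0 \<notin> C" "d \<noteq> 0"
  shows "card A ^ 3 * card B * card C \<le> 256 * (card (A * B) * card ((\<lambda>x. x + d) ` A * C))\<^sup>2"
proof -
  consider (empty) "card A = 0" | (singleton) "card A = 1" | (rich) "2 \<le> card A" by linarith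
  then show ?thesis
  proof cases
    case singleton
    then obtain a where A: "A = {a}" by (auto simp: card_1_singleton_iff)
    then have "card (A * B) = card B" "card ((\<lambda>x. x + d) ` A * C) = card C"
      using nz by (auto simp: card_singleton_times eq_neg_iff_add_eq_0)
    then show ?thesis
      using A by (simp add: power2_eq_square)
  next
    case rich
    then show ?thesis
      using assms by (intro cube_card_le_product_sets_if_two_le)
  qed simp
qed

theorem theorem3:
  shows "\<exists>c::real. c > 0 \<and>
    (\<forall>A B C :: real set.
       finite A \<and> A \<noteq> {} \<and> A \<subseteq> UNIV - {0, -1} \<and>
       finite B \<and> B \<noteq> {} \<and> B \<subseteq> UNIV - {0, -1} \<and>
       finite C \<and> C \<noteq> {} \<and> C \<subseteq> UNIV - {0, -1} \<longrightarrow>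
       real (card (A * B)) * real (card ((\<lambda>x. x + 1) ` A * C))
         \<ge> c * sqrt (real (card A) ^ 3 * real (card B) * real (card C)))"
proof (intro exI[of _ "1/16"] conjI allI impI)
  fix A B C :: "real set"
  assume "finite A \<and> A \<noteq> {} \<and> A \<subseteq> UNIV - {0, -1} \<and>
       finite B \<and> B \<noteq> {} \<and> B \<subseteq> UNIV - {0, -1} \<and>
       finite C \<and> C \<noteq> {} \<and> C \<subseteq> UNIV - {0, -1}"
  then have "card A ^ 3 * card B * card C
      \<le> 256 * (card (A * B) * card ((\<lambda>x. x + 1) ` A * C))\<^sup>2"
    by (intro cube_card_le_product_sets) auto
  also have "\<dots> = (16 * (card (A * B) * card ((\<lambda>x. x + 1) ` A * C)))\<^sup>2"
    by (simp add: power_mult_distrib)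
  finally have "real (card A ^ 3 * card B * card C)
      \<le> (real (16 * (card (A * B) * card ((\<lambda>x. x + 1) ` A * C))))\<^sup>2"
    by (metis of_nat_mono of_nat_power)
  then have "sqrt (real (card A ^ 3 * card B * card C))
      \<le> real (16 * (card (A * B) * card ((\<lambda>x. x + 1) ` A * C)))"
    by (intro real_le_lsqrt) simp_all
  then show "real (card (A * B)) * real (card ((\<lambda>x. x + 1) ` A * C))
      \<ge> 1/16 * sqrt (real (card A) ^ 3 * real (card B) * real (card C))"
    by simp
qed simp

end
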